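(* Let $k\ge 2$ be an integer and let $t\ge 0$ be the minimal nonnegative integer such that $k-t$ is prime. Then $HJ(k,2)\ge k-t$.
   Context: For $k\in\mathbb{Z}^+$ let $[k]=\{1,2,\dots,k\}$. A variable word over $[k]$ of length $n$ is a vector $w(x)\in([k]\cup\{x\})^n$ containing at least one occurrence of $x$; for $a\in[k]$, $w(a)\in[k]^n$ is obtained by replacing every occurrence of $x$ by $a$. The combinatorial line determined by $w(x)$ is $\{w(a):a\in[k]\}$. A (combinatorial) $m$-line (partial combinatorial line of length $m$) in $[k]^n$ is a set of the form $\{w(a):a\in\{i+1,\dots,i+m\}\}$ with $w(x)$ a variable word and $0\le i\le k-m$. For $k_1,k_2\in\mathbb{Z}^+$ and $K=\max(k_1,k_2)$, the off-diagonal Hales-Jewett number $HJ(k_1,k_2)=HJ(k_1,k_2;2)$ is the least positive integer $n$ such that every $2$-coloring of $[K]^n$ contains a monochromatic $k_1$-line of color $1$ or a monochromatic $k_2$-line of color $2$. *)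

theory Defs
  imports "HOL-Computational_Algebra.Primes" "HOL-Library.FuncSet"
begin

definition cube :: "nat \<Rightarrow> nat \<Rightarrow> nat list set" where
  "cube k n = {u. length u = n \<and> set u \<subseteq> {1..k}}"

text \<open>In a variable word, the letter \<open>None\<close> is the variable \<open>x\<close> and \<open>Some b\<close> is the
  letter \<open>b\<close> of the alphabet.\<close>

definition variable_words :: "nat \<Rightarrow> nat \<Rightarrow> nat option list set" where
  "variable_words k n =
     {w. length w = n \<and> set w \<subseteq> insert None (Some ` {1..k}) \<and> None \<in> set w}"

definition inst :: "nat option list \<Rightarrow> nat \<Rightarrow> nat list" where
  "inst w a = map (\<lambda>l. case l of None \<Rightarrow> a | Some b \<Rightarrow> b) w"

text \<open>The condition \<open>i \<le> k - m\<close> is written \<open>i + m \<le> k\<close> because of truncated subtraction;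
  in particular there are no \<open>m\<close>-lines when \<open>m > k\<close>.\<close>

definition partial_lines :: "nat \<Rightarrow> nat \<Rightarrow> nat \<Rightarrow> nat list set set" where
  "partial_lines k n m =
     {inst w ` {i+1..i+m} | w i. w \<in> variable_words k n \<and> i + m \<le> k}"

definition HJ_property :: "nat \<Rightarrow> nat \<Rightarrow> nat \<Rightarrow> bool" where
  "HJ_property k1 k2 n \<longleftrightarrow>
     (\<forall>c \<in> cube (max k1 k2) n \<rightarrow> {1, 2 :: nat}.
        (\<exists>L \<in> partial_lines (max k1 k2) n k1. \<forall>u \<in> L. c u = 1) \<or>
        (\<exists>L \<in> partial_lines (max k1 k2) n k2. \<forall>u \<in> L. c u = 2))"

text \<open>For positive \<open>k1\<close> and \<open>k2\<close> such an \<open>n\<close> exists by the Hales--Jewett theorem.\<close>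

definition HJ :: "nat \<Rightarrow> nat \<Rightarrow> nat" where
  "HJ k1 k2 = (LEAST n. n > 0 \<and> HJ_property k1 k2 n)"

end

theory Submission
  imports Defs "HOL-Number_Theory.Cong"
begin

text \<open>Let \<open>p = k - t\<close>, a prime with \<open>2 \<le> p \<le> k\<close>, and give a word color 2 exactly when \<open>p\<close> divides
  the sum of its letters.  Along a line with \<open>r\<close> active coordinates this sum is an arithmetic
  progression of common difference \<open>r\<close>.  If the length \<open>n\<close> is less than \<open>p\<close>, then \<open>0 < r < p\<close>, so
  \<open>r\<close> is invertible modulo \<open>p\<close>: any \<open>p\<close> consecutive terms of the progression meet every residue
  class, so a full line cannot avoid color 2, while two consecutive terms are
  never in the same class, so no 2-line has color 2 throughout.  Hence no \<open>n < p\<close> has the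
  Hales--Jewett property (\<open>HJ_property_imp_ge_prime\<close>).

  This bounds the least such \<open>n\<close> only if one exists at all.  Because the lines to be found in
  color 2 have only two points, existence follows from a pigeonhole argument in place of the
  Hales--Jewett theorem: length \<open>k + 1\<close> suffices (\<open>HJ_property_Suc\<close>).\<close>

text \<open>If every full line contains a point of color 2, then so does each of the lines
  \<open>x 1\<dots>1 2\<dots>2\<close> with \<open>k\<close> constant letters.  There are \<open>k + 1\<close> of them and only \<open>k\<close> possible values
  of \<open>x\<close> at such a point, so two of these points start with the same letter; they differ
  only in a block of ones that became twos, and so they form a 2-line.\<close>

lemma HJ_property_Suc:
  assumes "k \<ge> 2"
  shows "HJ_property k 2 (Suc k)"
  unfolding HJ_property_def
proof (intro ballI)
  fix c :: "nat list \<Rightarrow> nat"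
  assume c: "c \<in> cube (max k 2) (Suc k) \<rightarrow> {1, 2}"
  have k: "max k 2 = k" using assms by simp
  define tail where "tail i = replicate i 1 @ replicate (k - i) (2::nat)" for i
  show "(\<exists>L \<in> partial_lines (max k 2) (Suc k) k. \<forall>u \<in> L. c u = 1) \<or>
        (\<exists>L \<in> partial_lines (max k 2) (Suc k) 2. \<forall>u \<in> L. c u = 2)"
  proof (rule disjCI)
    assume no2: "\<not> (\<exists>L \<in> partial_lines (max k 2) (Suc k) 2. \<forall>u \<in> L. c u = 2)"
    show "\<exists>L \<in> partial_lines (max k 2) (Suc k) k. \<forall>u \<in> L. c u = 1"
    proof (rule ccontr)
      assume no1: "\<not> ?thesis"
      have "\<exists>a\<in>{1..k}. c (a # tail i) = 2" if i: "i \<le> k" for i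
      proof -
        define w where "w = None # map Some (tail i)"
        have "w \<in> variable_words k (Suc k)"
          using i assms by (auto simp: w_def tail_def variable_words_def)
        then have "inst w ` {0+1..0+k} \<in> partial_lines k (Suc k) k"
          unfolding partial_lines_def by fastforce
        with no1 k obtain a where a: "a \<in> {1..k}" "c (inst w a) \<noteq> 1"
          by fastforce
        have "inst w a = a # tail i"
          by (simp add: w_def inst_def o_def)
        moreover have "a # tail i \<in> cube k (Suc k)"
          using a i assms by (auto simp: cube_def tail_def)
        ultimately show ?thesis using a c k by (metis PiE insertE singletonD)
      qed
      then obtain f where f: "\<And>i. i \<le> k \<Longrightarrow> f i \<in> {1..k} \<and> c (f i # tail i) = 2"
        by metis
      have "\<not> inj_on f {0..k}"
      proof
        assume "inj_on f {0..k}"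
        moreover have "f ` {0..k} \<subseteq> {1..k}" by (rule image_subsetI) (use f in simp)
        ultimately have "card {0..k} \<le> card {1..k}" by (rule card_inj_on_le) simp
        then show False by simp
      qed
      then obtain i j where ij: "i < j" "j \<le> k" "f i = f j"
        unfolding inj_on_def by (metis atLeastAtMost_iff linorder_neqE_nat)
      define w where "w = Some (f i) # replicate i (Some 1) @ replicate (j - i) None
                            @ replicate (k - j) (Some 2)"
      have "w \<in> variable_words k (Suc k)"
        using ij f[of i] assms by (auto simp: w_def variable_words_def)
      then have "inst w ` {0+1..0+2} \<in> partial_lines k (Suc k) 2"
        using assms unfolding partial_lines_def by fastforce
      with no2 k obtain a where a: "a \<in> {1..2}" "c (inst w a) \<noteq> 2"
        by fastforce
      have "inst w 1 = f j # tail j"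
      proof -
        have "replicate j (1::nat) = replicate i 1 @ replicate (j - i) 1"
          using ij by (metis le_add_diff_inverse less_imp_le replicate_add)
        then show ?thesis by (simp add: w_def inst_def tail_def ij(3))
      qed
      moreover have "inst w 2 = f i # tail i"
      proof -
        have "replicate (k - i) (2::nat) = replicate (j - i) 2 @ replicate (k - j) 2"
          using ij by (simp flip: replicate_add)
        then show ?thesis by (simp add: w_def inst_def tail_def)
      qed
      moreover have "a = 1 \<or> a = 2" using a by auto
      ultimately show False using a f[of i] f[of j] ij by auto
    qed
  qed
qed

lemma sum_list_inst:
  "sum_list (inst w a) = sum_list (inst w 0) + a * count_list w None"
  by (induction w) (auto simp: inst_def split: option.splits)

text \<open>An arithmetic progression whose difference is invertible modulo \<open>p\<close> meets the zero class
  within any full period.\<close>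

lemma ex_dvd_arith_progression:
  fixes p r s :: nat
  assumes "coprime r p" "p > 0"
  shows "\<exists>a\<in>{1..p}. p dvd s + a * r"
proof -
  obtain x where x: "[r * x = 1] (mod p)"
    using cong_solve_coprime_nat[OF assms(1)] by auto
  define b where "b = x * (p - s mod p)"
  have "[s + b * r = s mod p + (r * x) * (p - s mod p)] (mod p)"
    by (auto simp: b_def mult_ac intro: cong_add)
  also have "[s mod p + (r * x) * (p - s mod p) = s mod p + 1 * (p - s mod p)] (mod p)"
    by (intro cong_add cong_mult x cong_refl)
  also have "s mod p + 1 * (p - s mod p) = p" using assms(2) by simp
  finally have b: "p dvd s + b * r" by (simp add: cong_def dvd_eq_mod_eq_0)
  \<comment> \<open>The representative of \<open>b\<close> is taken in \<open>{1..p}\<close>, so the class of 0 is represented by \<open>p\<close>.\<close>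
  define a where "a = (if b mod p = 0 then p else b mod p)"
  have "a \<in> {1..p}" using assms(2) by (auto simp: a_def Suc_le_eq less_imp_le)
  moreover have "[s + a * r = s + b * r] (mod p)"
    by (intro cong_add cong_mult cong_refl) (auto simp: a_def cong_def)
  then have "p dvd s + a * r" using b by (simp add: cong_dvd_iff)
  ultimately show ?thesis by blast
qed

lemma HJ_property_imp_ge_prime:
  assumes "HJ_property k 2 n" "prime p" "p \<le> k"
  shows "p \<le> n"
proof (rule ccontr)
  assume "\<not> p \<le> n"
  then have n: "n < p" by simp
  have k: "max k 2 = k" using prime_ge_2_nat[OF assms(2)] assms(3) by simp
  define c where "c u = (if p dvd sum_list u then 2 else 1 :: nat)" for u
  have r: "0 < count_list w None \<and> count_list w None < p" if "w \<in> variable_words k n" for w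
  proof
    show "0 < count_list w None"
      using that by (auto simp: variable_words_def count_list_0_iff intro!: Nat.gr0I)
    show "count_list w None < p"
      using that n count_le_length[of w None] by (auto simp: variable_words_def)
  qed
  have "c \<in> cube (max k 2) n \<rightarrow> {1, 2}" by (auto simp: c_def)
  with assms(1) k consider
      L where "L \<in> partial_lines k n k" "\<forall>u\<in>L. c u = 1"
    | L where "L \<in> partial_lines k n 2" "\<forall>u\<in>L. c u = 2"
    unfolding HJ_property_def by auto
  then show False
  proof cases
    case 1
    then obtain w where w: "w \<in> variable_words k n" and L: "L = inst w ` {1..k}"
      by (auto simp: partial_lines_def)
    have "\<not> p dvd count_list w None"
      using r[OF w] by (auto dest: dvd_imp_le)
    then have "coprime (count_list w None) p"
      using assms(2) by (simp add: prime_imp_coprime coprime_commute)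
    then obtain a where a: "a \<in> {1..p}" "p dvd sum_list (inst w 0) + a * count_list w None"
      using ex_dvd_arith_progression prime_gt_0_nat[OF assms(2)] by blast
    then have "c (inst w a) = 2" by (simp add: c_def sum_list_inst[of w a])
    moreover have "inst w a \<in> L" using a assms(3) L by auto
    ultimately show False using 1 by auto
  next
    case 2
    then obtain w i where w: "w \<in> variable_words k n" and L: "L = inst w ` {i+1..i+2}"
      by (auto simp: partial_lines_def)
    have "c (inst w (i+1)) = 2" "c (inst w (i+2)) = 2" using 2 L by auto
    then have "p dvd sum_list (inst w (i+1))" "p dvd sum_list (inst w (i+2))"
      by (auto simp: c_def split: if_splits)
    moreover have "sum_list (inst w (i+2)) = sum_list (inst w (i+1)) + count_list w None"
      using sum_list_inst[of w "i+1"] sum_list_inst[of w "i+2"] by (simp add: algebra_simps)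
    ultimately have "p dvd count_list w None" by (simp add: dvd_add_right_iff)
    then show False using r[OF w] by (auto dest: dvd_imp_le)
  qed
qed

theorem theorem15:
  fixes k t :: nat
  assumes "k \<ge> 2"
    and "t = (LEAST s. prime (k - s))"
  shows "HJ k 2 \<ge> k - t"
proof -
  have "prime (k - (k - 2))" using assms(1) by simp
  then have "prime (k - t)" unfolding assms(2) by (rule LeastI)
  moreover have "HJ k 2 > 0 \<and> HJ_property k 2 (HJ k 2)"
    unfolding HJ_def by (rule LeastI[of _ "Suc k"]) (use HJ_property_Suc[OF assms(1)] in simp)
  ultimately show ?thesis
    using HJ_property_imp_ge_prime[of k "HJ k 2" "k - t"] by simp
qed

end
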